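(* Let $r,k\in\mathbb{N}$, $-1<x,y<1$ and $0\le z\le1$. If $(x,y)\ne(0,0)$, then \begin{multline*} \mathcal{K}_{k,r}(x,y,z;\omega_1,\omega_2)=k!\sum_{l=r+1}^{k+r}\frac{\mathcal{H}_l(x,y;\omega_1,\omega_2)}{l!}\frac{\mathcal{B}^{\langle r\rangle}_{k+r-l}(z;\omega_2)}{(k+r-l)!} +k!\sum_{l=0}^{r}\frac{\mathcal{H}_l(x,y;\omega_1,\omega_2)}{l!}\Bigl(\frac{\mathcal{B}^{\langle r\rangle}_{k+r-l}(z;\omega_2)}{(k+r-l)!}\\ -\sum_{j=0}^{r-l}\frac{\mathcal{B}^{\langle r\rangle}_{r-j-l}(z;\omega_2)}{(r-j-l)!}\frac{(-1)^j}{j!}\frac{(k+j-1)!}{(k-1)!}\frac{\mathcal{B}_{k+j}(\{y+rz\};\omega_2)}{(k+j)!}\Bigr). \end{multline*} If $(x,y)=(0,0)$ and $z\ne1$, then \begin{multline*} \mathcal{K}_{k,r}(0,0,z;\omega_1,\omega_2)=k!\sum_{l=r+1}^{k+r}\frac{\mathcal{H}_l(\omega_1,\omega_2)}{l!}\frac{\mathcal{B}^{\langle r\rangle}_{k+r-l}(z;\omega_2)}{(k+r-l)!} +k!\sum_{\substack{l=0\\l\ne1}}^{r}\frac{\mathcal{H}_l(\omega_1,\omega_2)}{l!}\Bigl(\frac{\mathcal{B}^{\langle r\rangle}_{k+r-l}(z;\omega_2)}{(k+r-l)!}\\ -\sum_{j=0}^{r-l}\frac{\mathcal{B}^{\langle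 r\rangle}_{r-j-l}(z;\omega_2)}{(r-j-l)!}\frac{(-1)^j}{j!}\frac{(k+j-1)!}{(k-1)!}\frac{\mathcal{B}_{k+j}(\{rz\};\omega_2)}{(k+j)!}\Bigr). \end{multline*}
   Context: Let $\omega_1,\omega_2\in\mathbb{C}\setminus\{0\}$ with $\tau=\omega_2/\omega_1$, $\Im\tau>0$. Let $\theta(z;\tau)=-i\sum_{n\in\mathbb{Z}}\exp(\pi i(n+\tfrac12)^2\tau+2\pi i(n+\tfrac12)z+\pi in)$. For $-1<x,y<1$, $(x,y)\ne(0,0)$, let $\mathfrak{E}(\xi;x,y;\omega_1,\omega_2)=\frac{e^{2\pi ix\xi/\omega_1}}{\omega_1}\frac{\theta'(0;\tau)\theta(\xi/\omega_1+x\tau-y;\tau)}{\theta(\xi/\omega_1;\tau)\theta(x\tau-y;\tau)}$, and $\mathfrak{E}(\xi;0,0;\omega_1,\omega_2)=\frac{1}{\omega_1}\frac{\theta'(\xi/\omega_1;\tau)}{\theta(\xi/\omega_1;\tau)}+\frac{2\pi i\xi}{\omega_1\omega_2}$. The Hurwitz functions are the Laurent coefficients $\mathfrak{E}(\xi;x,y;\omega_1,\omega_2)=\sum_{k\ge0}\frac{\mathcal{H}_k(x,y;\omega_1,\omega_2)}{k!}\xi^{k-1}$ at $\xi=0$, and $\mathcal{H}_k(\omega_1,\omega_2)=\mathcal{H}_k(0,0;\omega_1,\omega_2)$. Let $\mathfrak{F}(\xi;z;\omega_2)=\frac{2\pi i}{\omega_2}\frac{e^{2\pi i\xi z/\omega_2}}{e^{2\pi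 i\xi/\omega_2}-1}$; $\mathcal{B}_k(z;\omega_2)=(2\pi i/\omega_2)^kB_k(z)$ and $\mathcal{B}^{\langle r\rangle}_j(z;\omega_2)=(2\pi i/\omega_2)^jB^{\langle r\rangle}_j(z)$, where $B_k$ are Bernoulli polynomials and $\bigl(te^{tx}/(e^t-1)\bigr)^r=\sum_{m\ge0}B^{\langle r\rangle}_m(x)t^m/m!$ (so $\mathfrak{F}^r=\sum_j\mathcal{B}^{\langle r\rangle}_j\xi^{j-r}/j!$). Let $\mathfrak{D}_r(\xi)=\mathfrak{E}(\xi;x,y;\omega_1,\omega_2)\mathfrak{F}(\xi;z;\omega_2)^r$; for $(x,y,z)\ne(0,0,1)$, $\mathfrak{K}_r(\xi;x,y,z;\omega_1,\omega_2)=\operatorname{Res}_{\eta=0}\bigl(\mathfrak{D}_r(\xi)\eta^{-1}-\mathfrak{D}_r(\eta)\mathfrak{F}(\xi-\eta;\{y+rz\};\omega_2)\bigr)$, and $\mathfrak{K}_r(\xi;0,0,1;\omega_1,\omega_2)=(-1)^{r+1}\mathfrak{K}_r(-\xi;0,0,0;\omega_1,\omega_2)$. This function is holomorphic at $\xi=0$, and $\mathcal{K}_{k,r}$ is defined by $\mathfrak{K}_r(\xi;x,y,z;\omega_1,\omega_2)=\sum_{k\ge1}\frac{\mathcal{K}_{k,r}(x,y,z;\omega_1,\omega_2)}{k!}\xi^{k-1}$. $\{t\}$ denotes the fractional part. *)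

theory Defs
  imports "HOL-Complex_Analysis.Complex_Analysis"
begin

definition jtheta :: "complex \<Rightarrow> complex \<Rightarrow> complex" where
  "jtheta z \<tau> = - \<i> * (\<Sum>\<^sub>\<infinity>n::int.
     exp (of_real pi * \<i> * (of_int n + 1 / 2)\<^sup>2 * \<tau>
          + 2 * of_real pi * \<i> * (of_int n + 1 / 2) * z
          + of_real pi * \<i> * of_int n))"

definition jtheta' :: "complex \<Rightarrow> complex \<Rightarrow> complex" where
  "jtheta' z \<tau> = deriv (\<lambda>w. jtheta w \<tau>) z"

definition \<EE> :: "complex \<Rightarrow> real \<Rightarrow> real \<Rightarrow> complex \<Rightarrow> complex \<Rightarrow> complex" where
  "\<EE> \<xi> x y \<omega>\<^sub>1 \<omega>\<^sub>2 =
     (let \<tau> = \<omega>\<^sub>2 / \<omega>\<^sub>1 in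
      if x = 0 \<and> y = 0 then
        1 / \<omega>\<^sub>1 * (jtheta' (\<xi> / \<omega>\<^sub>1) \<tau> / jtheta (\<xi> / \<omega>\<^sub>1) \<tau>)
        + 2 * of_real pi * \<i> * \<xi> / (\<omega>\<^sub>1 * \<omega>\<^sub>2)
      else
        exp (2 * of_real pi * \<i> * of_real x * \<xi> / \<omega>\<^sub>1) / \<omega>\<^sub>1
        * (jtheta' 0 \<tau> * jtheta (\<xi> / \<omega>\<^sub>1 + of_real x * \<tau> - of_real y) \<tau>)
        / (jtheta (\<xi> / \<omega>\<^sub>1) \<tau> * jtheta (of_real x * \<tau> - of_real y) \<tau>))"

text \<open>Defined through the \<^const>\<open>laurent_expansion\<close> at \<open>\<xi> = 0\<close>: the coefficient of
  \<open>\<xi>\<close> to the power \<open>k - 1\<close>, an integer exponent that is \<open>- 1\<close> for \<open>k = 0\<close>.\<close>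

definition hurwitz :: "nat \<Rightarrow> real \<Rightarrow> real \<Rightarrow> complex \<Rightarrow> complex \<Rightarrow> complex" where
  "hurwitz k x y \<omega>\<^sub>1 \<omega>\<^sub>2 =
     fact k * fls_nth (laurent_expansion (\<lambda>\<xi>. \<EE> \<xi> x y \<omega>\<^sub>1 \<omega>\<^sub>2) 0) (int k - 1)"

definition \<FF> :: "complex \<Rightarrow> real \<Rightarrow> complex \<Rightarrow> complex" where
  "\<FF> \<xi> z \<omega>\<^sub>2 =
     2 * of_real pi * \<i> / \<omega>\<^sub>2 * (exp (2 * of_real pi * \<i> * \<xi> * of_real z / \<omega>\<^sub>2)
       / (exp (2 * of_real pi * \<i> * \<xi> / \<omega>\<^sub>2) - 1))"

definition bernoulli_gf :: "real \<Rightarrow> real fps" where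
  "bernoulli_gf x = fps_X * fps_exp x / (fps_exp 1 - 1)"

definition bernpoly :: "nat \<Rightarrow> real \<Rightarrow> real" where
  "bernpoly k x = fact k * fps_nth (bernoulli_gf x) k"

text \<open>The \<open>r\<close>-th power is taken of the whole series, exponential factor included, so these are
  the usual Bernoulli polynomials of order \<open>r\<close> evaluated at \<open>r * x\<close>.\<close>

definition bernpoly_pow :: "nat \<Rightarrow> nat \<Rightarrow> real \<Rightarrow> real" where
  "bernpoly_pow r m x = fact m * fps_nth (bernoulli_gf x ^ r) m"

definition \<B> :: "nat \<Rightarrow> real \<Rightarrow> complex \<Rightarrow> complex" where
  "\<B> k z \<omega>\<^sub>2 = (2 * of_real pi * \<i> / \<omega>\<^sub>2) ^ k * of_real (bernpoly k z)"

definition \<B>pow :: "nat \<Rightarrow> nat \<Rightarrow> real \<Rightarrow> complex \<Rightarrow> complex" where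
  "\<B>pow r j z \<omega>\<^sub>2 = (2 * of_real pi * \<i> / \<omega>\<^sub>2) ^ j * of_real (bernpoly_pow r j z)"

definition \<DD> :: "nat \<Rightarrow> complex \<Rightarrow> real \<Rightarrow> real \<Rightarrow> real \<Rightarrow> complex \<Rightarrow> complex \<Rightarrow> complex" where
  "\<DD> r \<xi> x y z \<omega>\<^sub>1 \<omega>\<^sub>2 = \<EE> \<xi> x y \<omega>\<^sub>1 \<omega>\<^sub>2 * \<FF> \<xi> z \<omega>\<^sub>2 ^ r"

definition \<KK>_res :: "nat \<Rightarrow> complex \<Rightarrow> real \<Rightarrow> real \<Rightarrow> real \<Rightarrow> complex \<Rightarrow> complex \<Rightarrow> complex" where
  "\<KK>_res r \<xi> x y z \<omega>\<^sub>1 \<omega>\<^sub>2 =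
     residue (\<lambda>\<eta>. \<DD> r \<xi> x y z \<omega>\<^sub>1 \<omega>\<^sub>2 * inverse \<eta>
                  - \<DD> r \<eta> x y z \<omega>\<^sub>1 \<omega>\<^sub>2 * \<FF> (\<xi> - \<eta>) (frac (y + real r * z)) \<omega>\<^sub>2) 0"

definition \<KK> :: "nat \<Rightarrow> complex \<Rightarrow> real \<Rightarrow> real \<Rightarrow> real \<Rightarrow> complex \<Rightarrow> complex \<Rightarrow> complex" where
  "\<KK> r \<xi> x y z \<omega>\<^sub>1 \<omega>\<^sub>2 =
     (if x = 0 \<and> y = 0 \<and> z = 1
      then (-1) ^ (r + 1) * \<KK>_res r (- \<xi>) 0 0 0 \<omega>\<^sub>1 \<omega>\<^sub>2
      else \<KK>_res r \<xi> x y z \<omega>\<^sub>1 \<omega>\<^sub>2)"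

text \<open>The singularity of \<open>\<KK>\<close> at \<open>\<xi> = 0\<close> is removable, but the term \<open>\<KK> r 0 x y z \<omega>\<^sub>1 \<omega>\<^sub>2\<close>
  involves divisions by zero and need not equal the continuous extension. Taylor coefficients
  are therefore read off from the \<^const>\<open>laurent_expansion\<close>, which depends only on a
  punctured neighbourhood of \<open>0\<close>.\<close>

definition kcoeff :: "nat \<Rightarrow> nat \<Rightarrow> real \<Rightarrow> real \<Rightarrow> real \<Rightarrow> complex \<Rightarrow> complex \<Rightarrow> complex" where
  "kcoeff k r x y z \<omega>\<^sub>1 \<omega>\<^sub>2 =
     fact k * fls_nth (laurent_expansion (\<lambda>\<xi>. \<KK> r \<xi> x y z \<omega>\<^sub>1 \<omega>\<^sub>2) 0) (int k - 1)"

end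

theory Submission
  imports Defs
begin

text \<open>Write \<open>\<DD>(\<xi>) = \<Sum>\<^sub>n d\<^sub>n \<xi>\<^bsup>n - r - 1\<^esup>\<close>. For small \<open>\<xi> \<noteq> 0\<close> the kernel \<open>\<FF>(\<xi> - \<eta>)\<close> is analytic
  at \<open>\<eta> = 0\<close>, and expanding it in powers of \<open>\<eta>\<close> shows that the residue defining \<open>\<KK>\<close> is
  \<open>\<DD>(\<xi>) - \<Sum>\<^sub>j d\<^bsub>r - j\<^esub> (-1)\<^sup>j/j! \<FF>\<^bsup>(j)\<^esup>(\<xi>)\<close> with \<open>j \<le> r\<close>. The formula follows by comparing
  coefficients of \<open>\<xi>\<^bsup>k - 1\<^esup>\<close>, as \<open>d\<^sub>n\<close> is the Cauchy product of the Hurwitz and Bernoulli coefficients.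
  The analytic input is that \<open>\<theta>\<close> is entire and odd: \<open>\<EE>\<close> then has at most a simple pole at \<open>0\<close>, and
  for \<open>x = y = 0\<close> it is odd, so that \<open>\<H>\<^sub>1\<close> vanishes and the term \<open>l = 1\<close> may be left out.\<close>

section \<open>Theta function: convergence, holomorphy, oddness\<close>

text \<open>Completing the square. The left side is the real part of the exponent in a theta term,
  with \<open>a = Im \<tau>\<close>, \<open>m = n + 1/2\<close> and \<open>y = Im z\<close>. The
  summand 1 in \<open>b\<close> sets aside the term \<open>- \<bar>m\<bar>\<close>, which makes the
  majorant geometric and uniform in \<open>y\<close>.\<close>

lemma theta_exponent_bound:
  fixes a m y R :: real
  assumes "a > 0" "\<bar>y\<bar> \<le> R"
  shows "- (pi * a * m\<^sup>2) - 2 * pi * m * y \<le> (2 * pi * R + 1)\<^sup>2 / (4 * pi * a) - \<bar>m\<bar>"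
proof -
  define b where "b = 2 * pi * R + 1"
  have pa: "pi * a > 0" using assms by simp
  have "m * y \<ge> - (\<bar>m\<bar> * R)"
    using mult_left_mono[OF assms(2) abs_ge_zero[of m]] abs_ge_minus_self[of "m * y"]
    by (simp add: abs_mult)
  hence "2 * pi * (m * y) \<ge> 2 * pi * (- (\<bar>m\<bar> * R))"
    by (intro mult_left_mono) auto
  moreover have "b * \<bar>m\<bar> - pi * a * m\<^sup>2 \<le> b\<^sup>2 / (4 * (pi * a))"
  proof -
    have "0 \<le> (b - 2 * (pi * a) * \<bar>m\<bar>)\<^sup>2" by simp
    also have "\<dots> = b\<^sup>2 - 4 * (pi * a) * (b * \<bar>m\<bar> - pi * a * m\<^sup>2)"
      by (simp add: power2_eq_square algebra_simps)
    finally have "(b * \<bar>m\<bar> - pi * a * m\<^sup>2) * (4 * (pi * a)) \<le> b\<^sup>2"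
      by (simp add: mult.commute)
    thus ?thesis using pa by (subst pos_le_divide_eq) auto
  qed
  ultimately show ?thesis
    by (simp add: b_def algebra_simps)
qed

lemma summable_on_exp_neg_abs_half_int:
  "(\<lambda>n::int. exp (- \<bar>of_int n + 1 / 2 :: real\<bar>)) summable_on UNIV"
proof -
  let ?g = "\<lambda>n::int. exp (- \<bar>of_int n + 1 / 2 :: real\<bar>)"
  have "summable (\<lambda>n::nat. exp (- 1 :: real) ^ n * exp (- 1 / 2))"
    by (intro summable_mult2 summable_geometric) auto
  also have "(\<lambda>n::nat. exp (- 1 :: real) ^ n * exp (- 1 / 2)) = (\<lambda>n. exp (- (real n + 1 / 2)))"
    by (simp flip: exp_of_nat_mult exp_add)
  finally have s: "(\<lambda>n. exp (- (real n + 1 / 2))) summable_on UNIV"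
    by (subst summable_on_UNIV_nonneg_real_iff) auto
  \<comment> \<open>The halves \<open>n \<ge> 0\<close> and \<open>n = - k - 1\<close> of the
    integers give the same values \<open>k + 1/2\<close> of the absolute value, hence two copies of
    one geometric series.\<close>
  have "?g summable_on range int"
    using s by (subst summable_on_reindex) (auto simp: o_def)
  moreover have "?g summable_on range (\<lambda>n. - int n - 1)"
    using s by (subst summable_on_reindex) (auto simp: o_def inj_on_def abs_if)
  ultimately have "?g summable_on (range int \<union> range (\<lambda>n. - int n - 1))"
    by (rule summable_on_union)
  moreover have "n \<in> range int \<union> range (\<lambda>n. - int n - 1)" for n
  proof (cases "n \<ge> 0")
    case True
    hence "n = int (nat n)" by simp
    thus ?thesis by blast
  next
    case False
    hence "n = - int (nat (- n - 1)) - 1" by simp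
    thus ?thesis by blast
  qed
  hence "range int \<union> range (\<lambda>n. - int n - 1) = UNIV"
    by blast
  ultimately show ?thesis by simp
qed

text \<open>Weierstrass M-test on each disc of radius \<open>R\<close>: the finite partial sums are
  entire and converge uniformly, and every point lies in such a disc.\<close>

lemma jtheta_holomorphic:
  assumes "Im \<tau> > 0"
  shows "(\<lambda>z. jtheta z \<tau>) holomorphic_on UNIV"
proof -
  define f where "f = (\<lambda>(n::int) z. exp (of_real pi * \<i> * (of_int n + 1 / 2)\<^sup>2 * \<tau>
          + 2 * of_real pi * \<i> * (of_int n + 1 / 2) * z + of_real pi * \<i> * of_int n))"
  have jt: "jtheta z \<tau> = - \<i> * (\<Sum>\<^sub>\<infinity>n. f n z)" for z
    by (simp add: jtheta_def f_def)
  have holo: "(\<lambda>z. \<Sum>\<^sub>\<infinity>n. f n z) holomorphic_on ball 0 R" for R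
  proof -
    define M where "M = (\<lambda>n::int. exp ((2 * pi * R + 1)\<^sup>2 / (4 * pi * Im \<tau>))
                          * exp (- \<bar>of_int n + 1 / 2 :: real\<bar>))"
    have "norm (f n z) \<le> M n" if "z \<in> cball 0 R" for n z
    proof -
      define m where "m = of_int n + (1 / 2 :: real)"
      have m: "of_int n + 1 / 2 = complex_of_real m" by (simp add: m_def)
      have "\<bar>Im z\<bar> \<le> R" using that abs_Im_le_cmod[of z] by simp
      from theta_exponent_bound[OF assms this, of m]
      have "exp (- (pi * Im \<tau> * m\<^sup>2) - 2 * pi * m * Im z) \<le> M n"
        by (simp add: M_def m_def flip: exp_add)
      moreover have "norm (f n z) = exp (- (pi * Im \<tau> * m\<^sup>2) - 2 * pi * m * Im z)"
        unfolding f_def m norm_exp_eq_Re exp_inj_iff by (simp flip: of_real_power)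
      ultimately show ?thesis by simp
    qed
    moreover have "M summable_on UNIV"
      unfolding M_def by (intro summable_on_cmult_right summable_on_exp_neg_abs_half_int)
    ultimately have ul: "uniform_limit (cball 0 R) (\<lambda>X z. \<Sum>n\<in>X. f n z)
                       (\<lambda>z. \<Sum>\<^sub>\<infinity>n. f n z) (finite_subsets_at_top UNIV)"
      by (intro Weierstrass_m_test_general) auto
    have "(\<lambda>z. \<Sum>n\<in>X. f n z) holomorphic_on UNIV" for X
      unfolding f_def by (intro holomorphic_intros)
    hence "continuous_on (cball 0 R) (\<lambda>z. \<Sum>n\<in>X. f n z)"
          "(\<lambda>z. \<Sum>n\<in>X. f n z) holomorphic_on ball 0 R" for X
      by (meson holomorphic_on_imp_continuous_on holomorphic_on_subset subset_UNIV)+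
    thus ?thesis
      using holomorphic_uniform_limit[OF _ ul] by (simp add: always_eventually)
  qed
  have "(\<lambda>z. \<Sum>\<^sub>\<infinity>n. f n z) analytic_on {z}" for z
    using holo[of "norm z + 1"] unfolding analytic_at
    by (intro exI[of _ "ball 0 (norm z + 1)"]) auto
  hence "(\<lambda>z. \<Sum>\<^sub>\<infinity>n. f n z) holomorphic_on UNIV"
    by (metis UNIV_I analytic_imp_holomorphic analytic_on_analytic_at)
  thus ?thesis unfolding jt by (intro holomorphic_intros)
qed

text \<open>The reindexing \<open>n \<mapsto> - n - 1\<close> negates \<open>n + 1/2\<close>.
  Together with \<open>z \<mapsto> - z\<close> it preserves the quadratic and the linear part of the
  exponent, while the factor \<open>exp (pi * \<i> * n)\<close> changes sign.\<close>

lemma jtheta_uminus: "jtheta (- z) \<tau> = - jtheta z \<tau>"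
proof -
  define f where "f = (\<lambda>(n::int) z. exp (of_real pi * \<i> * (of_int n + 1 / 2)\<^sup>2 * \<tau>
          + 2 * of_real pi * \<i> * (of_int n + 1 / 2) * z + of_real pi * \<i> * of_int n))"
  have jt: "jtheta z \<tau> = - \<i> * (\<Sum>\<^sub>\<infinity>n. f n z)" for z
    by (simp add: jtheta_def f_def)
  have *: "f (- n - 1) (- z) = - f n z" for n
  proof -
    have "exp (- (2 * of_int n * of_real pi * \<i>)) = (1 :: complex)"
      using exp_integer_2pi[of "of_int (- n)"] by (simp add: algebra_simps)
    moreover have "exp (- (of_real pi * \<i>)) = (- 1 :: complex)"
      by (simp add: exp_minus)
    ultimately have "exp (- (2 * of_int n * of_real pi * \<i>) + - (of_real pi * \<i>)) = (- 1 :: complex)"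
      by (simp only: exp_add mult_1_left)
    hence "- f n z = f n z * exp (- (2 * of_int n * of_real pi * \<i>) + - (of_real pi * \<i>))"
      by simp
    also have "\<dots> = f (- n - 1) (- z)"
      unfolding f_def exp_add[symmetric]
      by (rule arg_cong[where f = exp]) (simp add: field_simps power2_eq_square)
    finally show ?thesis ..
  qed
  have "f n (- z) = - f (- n - 1) z" for n
    using *[of "- n - 1"] by simp
  hence "(\<Sum>\<^sub>\<infinity>n. f n (- z)) = (\<Sum>\<^sub>\<infinity>n. - f n z)"
    by (intro infsum_reindex_bij_witness[where i = "\<lambda>n. - n - 1" and j = "\<lambda>n. - n - 1"]) auto
  thus ?thesis by (simp add: jt infsum_uminus)
qed

section \<open>Laurent series at 0\<close>

lemma laurent_expansion_eqI:
  assumes "f has_laurent_expansion F"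
  shows "laurent_expansion f 0 = F"
  using has_laurent_expansion_unique[OF _ assms]
        not_essential_has_laurent_expansion[of f 0]
        has_laurent_expansion_isolated_0[OF assms] has_laurent_expansion_not_essential_0[OF assms]
  by simp

text \<open>Substituting \<open>- z\<close> multiplies the coefficient of exponent \<open>n\<close>
  by \<open>(-1)^n\<close>; at \<open>n = 0\<close> oddness makes the coefficient equal to its own
  negative.\<close>

lemma has_laurent_expansion_odd_imp_nth_0:
  assumes f: "f has_laurent_expansion F" and odd: "\<And>z. f (- z) = - f z"
  shows "fls_nth F 0 = 0"
proof -
  have "(f \<circ> (\<lambda>z. - 1 * z)) has_laurent_expansion fls_compose_fps F (fps_const (- 1) * fps_X)"
    by (intro has_laurent_expansion_compose[OF f] has_laurent_expansion_fps
              has_fps_expansion_cmult_left has_fps_expansion_fps_X) auto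
  moreover have "f \<circ> (\<lambda>z. - 1 * z) = (\<lambda>z. - f z)"
    by (auto simp: odd)
  ultimately have "fls_compose_fps F (fps_const (- 1) * fps_X) = - F"
    using has_laurent_expansion_unique has_laurent_expansion_minus[OF f] by metis
  hence "fls_nth (fls_compose_fps F (fps_const (- 1) * fps_X)) 0 = fls_nth (- F) 0"
    by simp
  thus ?thesis
    by (subst (asm) fls_nth_fls_compose_fps_linear) (auto simp: complex_eq_iff)
qed

lemma fls_eq_shift_1_if_subdegree_ge:
  assumes "F \<noteq> 0 \<Longrightarrow> fls_subdegree F \<ge> - 1"
  shows "F = fls_shift 1 (fps_to_fls (Abs_fps (\<lambda>n. fls_nth F (int n - 1))))"
proof (rule fls_eqI)
  fix n
  have "fls_nth F n = 0" if "n < - 1"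
    using assms that by (cases "F = 0") (auto intro: fls_eq0_below_subdegree)
  thus "fls_nth F n = fls_nth (fls_shift 1 (fps_to_fls (Abs_fps (\<lambda>n. fls_nth F (int n - 1))))) n"
    by auto
qed

section \<open>Expansion of \<open>\<EE>\<close> and the Hurwitz coefficients\<close>

text \<open>Since \<open>hurwitz\<close> is read off from the exponents
  \<open>- 1, 0, 1, ...\<close>, the content is that the pole at 0 is at most simple. For
  \<open>x = y = 0\<close> this comes from a logarithmic derivative, otherwise from a quotient whose
  denominator vanishes to order at most 1.\<close>

lemma EE_has_laurent_expansion:
  assumes w1: "\<omega>\<^sub>1 \<noteq> 0" and im: "Im (\<omega>\<^sub>2 / \<omega>\<^sub>1) > 0"
  shows "(\<lambda>\<xi>. \<EE> \<xi> x y \<omega>\<^sub>1 \<omega>\<^sub>2) has_laurent_expansion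
           fls_shift 1 (fps_to_fls (Abs_fps (\<lambda>l. hurwitz l x y \<omega>\<^sub>1 \<omega>\<^sub>2 / fact l)))"
proof -
  let ?\<tau> = "\<omega>\<^sub>2 / \<omega>\<^sub>1"
  define t where "t = (\<lambda>\<xi>. jtheta (\<xi> / \<omega>\<^sub>1) ?\<tau>)"
  have hol: "(\<lambda>z. jtheta z ?\<tau>) holomorphic_on UNIV"
    by (rule jtheta_holomorphic[OF im])
  have comp: "(\<lambda>\<xi>. jtheta (\<xi> / \<omega>\<^sub>1 + c) ?\<tau>) analytic_on {0}" for c
  proof -
    have "(\<lambda>\<xi>. \<xi> / \<omega>\<^sub>1 + c) holomorphic_on UNIV"
      using w1 by (intro holomorphic_intros) auto
    from holomorphic_on_compose_gen[OF this hol] show ?thesis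
      by (auto simp: analytic_at o_def)
  qed
  have der: "(t has_field_derivative jtheta' (\<xi> / \<omega>\<^sub>1) ?\<tau> / \<omega>\<^sub>1) (at \<xi>)" for \<xi>
  proof -
    have "((\<lambda>z. jtheta z ?\<tau>) has_field_derivative jtheta' (\<xi> / \<omega>\<^sub>1) ?\<tau>) (at (\<xi> / \<omega>\<^sub>1))"
      unfolding jtheta'_def by (rule holomorphic_derivI[OF hol]) auto
    from DERIV_chain2[where g = "\<lambda>\<xi>. \<xi> / \<omega>\<^sub>1", OF this DERIV_cdivide[OF DERIV_ident]]
    show ?thesis unfolding t_def by simp
  qed
  obtain T where T: "t has_fps_expansion T"
    using analytic_at_imp_has_fps_expansion_0[OF comp[of 0]] by (auto simp: t_def)
  have T': "deriv t has_fps_expansion fps_deriv T"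
    by (rule has_fps_expansion_deriv[OF T])
  have "\<exists>L. (\<lambda>\<xi>. \<EE> \<xi> x y \<omega>\<^sub>1 \<omega>\<^sub>2) has_laurent_expansion L \<and> (L \<noteq> 0 \<longrightarrow> fls_subdegree L \<ge> - 1)"
  proof (cases "x = 0 \<and> y = 0")
    case True
    have E: "(\<lambda>\<xi>. \<EE> \<xi> x y \<omega>\<^sub>1 \<omega>\<^sub>2) = (\<lambda>\<xi>. deriv t \<xi> / t \<xi> + 2 * of_real pi * \<i> / (\<omega>\<^sub>1 * \<omega>\<^sub>2) * \<xi>)"
      using DERIV_imp_deriv[OF der] True by (auto simp: \<EE>_def Let_def t_def)
    define L where "L = fps_to_fls (fps_deriv T) / fps_to_fls T"
    \<comment> \<open>Differentiation lowers the order of vanishing by at most 1, so a logarithmic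
      derivative has at most a simple pole, whatever the order of the zero of
      \<open>t\<close>.\<close>
    have "fls_nth L n = 0" if n: "n < - 1" for n
    proof (cases "L = 0")
      case False
      hence "T \<noteq> 0" "fps_deriv T \<noteq> 0" by (auto simp: L_def)
      hence "fls_subdegree L = int (subdegree (fps_deriv T)) - int (subdegree T)"
        by (simp add: L_def fls_divide_subdegree fls_subdegree_fls_to_fps)
      moreover have "fps_nth T (Suc i) = 0" if "i < subdegree T - 1" for i
        using that by (intro nth_less_subdegree_zero) linarith
      hence "subdegree T - 1 \<le> subdegree (fps_deriv T)"
        using \<open>fps_deriv T \<noteq> 0\<close> by (intro subdegree_geI) auto
      ultimately show ?thesis using n by (intro fls_eq0_below_subdegree) auto
    qed auto
    hence "fls_subdegree (L + fls_const (2 * of_real pi * \<i> / (\<omega>\<^sub>1 * \<omega>\<^sub>2)) * fls_X) \<ge> - 1"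
      if "L + fls_const (2 * of_real pi * \<i> / (\<omega>\<^sub>1 * \<omega>\<^sub>2)) * fls_X \<noteq> 0"
      using that by (intro fls_subdegree_geI) auto
    moreover have "(\<lambda>\<xi>. \<EE> \<xi> x y \<omega>\<^sub>1 \<omega>\<^sub>2) has_laurent_expansion
        L + fls_const (2 * of_real pi * \<i> / (\<omega>\<^sub>1 * \<omega>\<^sub>2)) * fls_X"
      unfolding E L_def using T T'
      by (intro laurent_expansion_intros has_laurent_expansion_fps) auto
    ultimately show ?thesis by blast
  next
    case False
    let ?c = "of_real x * ?\<tau> - of_real y"
    \<comment> \<open>If \<open>jtheta ?c ?\<tau>\<close> is zero, division by zero makes
      \<open>C\<close> zero, and the identity \<open>E\<close> below still holds for all
      \<open>\<xi>\<close>.\<close>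
    define C where "C = jtheta' 0 ?\<tau> / (\<omega>\<^sub>1 * jtheta ?c ?\<tau>)"
    define N where "N = (\<lambda>\<xi>. exp (2 * of_real pi * \<i> * of_real x / \<omega>\<^sub>1 * \<xi>) * jtheta (\<xi> / \<omega>\<^sub>1 + ?c) ?\<tau>)"
    have E: "\<EE> \<xi> x y \<omega>\<^sub>1 \<omega>\<^sub>2 = C * (N \<xi> / t \<xi>)" for \<xi>
      using False by (auto simp: \<EE>_def Let_def t_def C_def N_def algebra_simps add_diff_eq)
    show ?thesis
      \<comment> \<open>If \<open>\<theta>'(0) = 0\<close>, the function vanishes identically, so the simplicity of the zero of
        \<open>\<theta>\<close> at \<open>0\<close> need not be established.\<close>
    proof (cases "jtheta' 0 ?\<tau> = 0")
      case True
      hence "(\<lambda>\<xi>. \<EE> \<xi> x y \<omega>\<^sub>1 \<omega>\<^sub>2) has_laurent_expansion 0"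
        by (simp add: E C_def)
      thus ?thesis by blast
    next
      case False
      have "N analytic_on {0}"
        unfolding N_def by (intro analytic_intros comp)
      then obtain P where P: "N has_fps_expansion P"
        using analytic_at_imp_has_fps_expansion_0 by blast
      \<comment> \<open>By the chain rule the linear coefficient of \<open>t\<close> is a nonzero
        multiple of \<open>jtheta' 0 ?\<tau>\<close>; hence \<open>T\<close> has order at most 1 and
        dividing by it costs at most one power of \<open>\<xi>\<close>.\<close>
      have "fps_nth T 1 = jtheta' 0 ?\<tau> / \<omega>\<^sub>1"
        using fps_nth_fps_expansion[OF T, of 1] DERIV_imp_deriv[OF der[of 0]] by simp
      hence T1: "fps_nth T 1 \<noteq> 0" using False w1 by simp
      let ?L = "fls_const C * (fps_to_fls P / fps_to_fls T)"
      have "fls_subdegree ?L \<ge> - 1" if "?L \<noteq> 0"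
      proof -
        have "fls_subdegree ?L = int (subdegree P) - int (subdegree T)"
          using that by (auto simp: fls_divide_subdegree fls_subdegree_fls_to_fps)
        thus ?thesis using subdegree_leI[OF T1] by simp
      qed
      moreover have "(\<lambda>\<xi>. \<EE> \<xi> x y \<omega>\<^sub>1 \<omega>\<^sub>2) has_laurent_expansion ?L"
        unfolding E using T P by (intro laurent_expansion_intros has_laurent_expansion_fps)
      ultimately show ?thesis by blast
    qed
  qed
  then obtain L where L: "(\<lambda>\<xi>. \<EE> \<xi> x y \<omega>\<^sub>1 \<omega>\<^sub>2) has_laurent_expansion L"
      "L \<noteq> 0 \<Longrightarrow> fls_subdegree L \<ge> - 1" by blast
  have "hurwitz l x y \<omega>\<^sub>1 \<omega>\<^sub>2 / fact l = fls_nth L (int l - 1)" for l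
    by (simp add: hurwitz_def laurent_expansion_eqI[OF L(1)])
  thus ?thesis using L(1) fls_eq_shift_1_if_subdegree_ge[OF L(2)] by simp
qed

text \<open>Differentiating \<open>\<theta>(-z) = -\<theta>(z)\<close> shows that the derivative is
  even, so both the logarithmic derivative and the linear term of \<open>\<EE>\<close> are odd. The
  index 1 belongs to the exponent 0.\<close>

lemma hurwitz_1_0_0:
  assumes "\<omega>\<^sub>1 \<noteq> 0" and im: "Im (\<omega>\<^sub>2 / \<omega>\<^sub>1) > 0"
  shows "hurwitz 1 0 0 \<omega>\<^sub>1 \<omega>\<^sub>2 = 0"
proof -
  let ?\<tau> = "\<omega>\<^sub>2 / \<omega>\<^sub>1"
  have "jtheta' (- z) ?\<tau> = jtheta' z ?\<tau>" for z
  proof -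
    have d: "((\<lambda>z. jtheta z ?\<tau>) has_field_derivative jtheta' z ?\<tau>) (at z)" for z
      unfolding jtheta'_def by (rule holomorphic_derivI[OF jtheta_holomorphic[OF im]]) auto
    have "((\<lambda>z. jtheta (- z) ?\<tau>) has_field_derivative jtheta' (- z) ?\<tau> * - 1) (at z)"
      by (rule DERIV_chain2[OF d]) (auto intro!: derivative_eq_intros)
    from DERIV_unique[OF this[unfolded jtheta_uminus] DERIV_minus[OF d]] show ?thesis
      by simp
  qed
  hence "\<EE> (- \<xi>) 0 0 \<omega>\<^sub>1 \<omega>\<^sub>2 = - \<EE> \<xi> 0 0 \<omega>\<^sub>1 \<omega>\<^sub>2" for \<xi>
    by (simp add: \<EE>_def Let_def jtheta_uminus)
  from has_laurent_expansion_odd_imp_nth_0[OF EE_has_laurent_expansion[OF assms] this]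
  show ?thesis by simp
qed

section \<open>Bernoulli series and the expansion of \<open>\<FF>\<close>\<close>

text \<open>Over a field, divisibility of power series compares orders: \<open>fps_exp 1 - 1\<close>
  has order at most 1. This makes the division in \<open>bernoulli_gf\<close> exact.\<close>

lemma fps_exp_1_minus_1_dvd: "fps_exp 1 - 1 dvd fps_X * (p :: real fps)"
proof (cases "p = 0")
  case False
  have "fps_exp 1 - 1 \<noteq> (0 :: real fps)"
    by (auto simp: fps_eq_iff intro!: exI[of _ 1])
  moreover have "subdegree (fps_exp 1 - 1 :: real fps) \<le> 1"
    by (rule subdegree_leI) simp
  ultimately show ?thesis
    using False by (simp add: fps_dvd_iff)
qed auto

lemma bernoulli_gf_times: "bernoulli_gf x * (fps_exp 1 - 1) = fps_X * fps_exp x"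
  unfolding bernoulli_gf_def by (rule dvd_div_mult_self[OF fps_exp_1_minus_1_dvd])

text \<open>The substitution of \<open>c * X\<close> for \<open>X\<close>, combined with the
  embedding of real into complex coefficients. With
  \<open>c = 2 * pi * \<i> / \<omega>\<^sub>2\<close> it turns the Bernoulli series into that of
  \<open>\<B>\<close>; being multiplicative, it carries powers to \<open>\<B>pow\<close>.\<close>

definition fps_scale_of_real :: "complex \<Rightarrow> real fps \<Rightarrow> complex fps" where
  "fps_scale_of_real c p = Abs_fps (\<lambda>n. c ^ n * of_real (fps_nth p n))"

lemma fps_scale_of_real_mult:
  "fps_scale_of_real c (p * q) = fps_scale_of_real c p * fps_scale_of_real c q"
proof (rule fps_ext)
  fix n
  have "c ^ n * of_real (fps_nth p i * fps_nth q (n - i)) =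
        c ^ i * of_real (fps_nth p i) * (c ^ (n - i) * of_real (fps_nth q (n - i)))"
    if "i \<in> {0..n}" for i
    using that by (simp add: mult_ac flip: power_add)
  thus "fps_nth (fps_scale_of_real c (p * q)) n =
        fps_nth (fps_scale_of_real c p * fps_scale_of_real c q) n"
    by (simp add: fps_scale_of_real_def fps_mult_nth sum_distrib_left del: of_real_mult)
qed

lemma fps_scale_of_real_power:
  "fps_scale_of_real c (p ^ r) = fps_scale_of_real c p ^ r"
proof (induction r)
  case 0
  show ?case by (auto simp: fps_scale_of_real_def fps_eq_iff)
qed (simp add: fps_scale_of_real_mult)

text \<open>Rescaling \<open>bernoulli_gf_times\<close> by \<open>c\<close> gives a relation that
  determines the series after division by \<open>fps_exp c - 1\<close>, which is legitimate among
  Laurent series because \<open>c\<close> is nonzero.\<close>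

lemma FF_has_laurent_expansion:
  assumes w2: "\<omega>\<^sub>2 \<noteq> 0"
  shows "(\<lambda>\<xi>. \<FF> \<xi> z \<omega>\<^sub>2) has_laurent_expansion
           fls_shift 1 (fps_to_fls (fps_scale_of_real (2 * of_real pi * \<i> / \<omega>\<^sub>2) (bernoulli_gf z)))"
proof -
  define c where "c = 2 * of_real pi * \<i> / \<omega>\<^sub>2"
  have c: "c \<noteq> 0" using w2 by (simp add: c_def)
  let ?B = "fps_scale_of_real c (bernoulli_gf z)"
  have F: "(\<lambda>\<xi>. \<FF> \<xi> z \<omega>\<^sub>2) = (\<lambda>\<xi>. c * (exp (c * of_real z * \<xi>) / (exp (c * \<xi>) - 1)))"
    by (simp add: \<FF>_def c_def mult_ac)
  have "fps_scale_of_real c (fps_exp 1 - 1) = fps_exp c - 1"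
    by (auto simp: fps_eq_iff fps_scale_of_real_def)
  moreover have "fps_scale_of_real c (fps_X * fps_exp z) = fps_const c * fps_X * fps_exp (c * of_real z)"
  proof (rule fps_ext)
    fix n
    show "fps_nth (fps_scale_of_real c (fps_X * fps_exp z)) n =
          fps_nth (fps_const c * fps_X * fps_exp (c * of_real z)) n"
      by (cases n) (simp_all add: fps_scale_of_real_def mult.assoc power_mult_distrib)
  qed
  ultimately have B: "?B * (fps_exp c - 1) = fps_const c * fps_X * fps_exp (c * of_real z)"
    using arg_cong[OF bernoulli_gf_times, of "fps_scale_of_real c" z]
    by (simp only: fps_scale_of_real_mult)
  have nz: "fps_exp c - 1 \<noteq> 0"
    using c by (auto simp: fps_eq_iff intro!: exI[of _ 1])
  have "fls_shift 1 (fps_to_fls ?B) * fps_to_fls (fps_exp c - 1) =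
        fls_X_inv * fps_to_fls (?B * (fps_exp c - 1))"
    by (simp add: fls_times_fps_to_fls fls_X_inv_times_conv_shift fls_shifted_times_simps)
  also have "\<dots> = fls_const c * fps_to_fls (fps_exp (c * of_real z))"
    unfolding B by (simp add: fls_times_fps_to_fls mult_ac fls_X_inv_times_conv_shift fls_X_times_conv_shift)
  finally have "fls_shift 1 (fps_to_fls ?B) =
        fls_const c * (fps_to_fls (fps_exp (c * of_real z)) / fps_to_fls (fps_exp c - 1))"
    using nz by (simp add: field_simps)
  moreover have "(\<lambda>\<xi>. \<FF> \<xi> z \<omega>\<^sub>2) has_laurent_expansion
        fls_const c * (fps_to_fls (fps_exp (c * of_real z)) / fps_to_fls (fps_exp c - 1))"
    unfolding F by (intro laurent_expansion_intros has_laurent_expansion_fps fps_expansion_intros)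
  ultimately show ?thesis by (simp add: c_def)
qed

section \<open>The residue as a Laurent series in \<open>\<xi>\<close>\<close>

text \<open>The factor is the product of the exponents \<open>k, ..., k + j - 1\<close> brought down
  by differentiation. The induction varies \<open>k\<close> because the outermost derivative raises
  it by one.\<close>

lemma fls_nth_deriv_funpow:
  fixes F :: "'a :: field_char_0 fls"
  assumes "k \<ge> 1"
  shows "fls_nth ((fls_deriv ^^ j) F) (int k - 1) =
           fact (k + j - 1) / fact (k - 1) * fls_nth F (int (k + j) - 1)"
  using assms
proof (induction j arbitrary: k)
  case (Suc j)
  have "fls_nth ((fls_deriv ^^ Suc j) F) (int k - 1) = of_nat k * fls_nth ((fls_deriv ^^ j) F) (int (Suc k) - 1)"
    by simp
  also have "\<dots> = of_nat k * (fact (k + j) / fact k) * fls_nth F (int (k + Suc j) - 1)"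
    by (subst Suc.IH) auto
  also have "of_nat k * (fact (k + j) / fact k) = (fact (k + j) / fact (k - 1) :: 'a)"
    using Suc.prems by (subst fact_reduce) auto
  finally show ?case by simp
qed auto

lemma residue_diff_kernel:
  assumes D: "D has_laurent_expansion fls_shift (int r + 1) (fps_to_fls P)"
    and h: "h analytic_on {\<xi>}"
  shows "residue (\<lambda>\<eta>. d * inverse \<eta> - D \<eta> * h (\<xi> - \<eta>)) 0 =
           d - (\<Sum>i\<le>r. fps_nth P (r - i) * ((-1) ^ i / fact i) * (deriv ^^ i) h \<xi>)"
proof -
  define G where "G = fps_compose (fps_expansion h \<xi>) (fps_const (- 1) * fps_X)"
  have "((\<lambda>x. h (\<xi> + x)) \<circ> (\<lambda>\<eta>. - 1 * \<eta>)) has_fps_expansion G"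
    unfolding G_def
    by (intro has_fps_expansion_compose analytic_at_imp_has_fps_expansion h
              has_fps_expansion_cmult_left has_fps_expansion_fps_X) auto
  hence G: "(\<lambda>\<eta>. h (\<xi> - \<eta>)) has_fps_expansion G"
    by (simp add: o_def)
  have nth: "fps_nth G i = (-1) ^ i / fact i * (deriv ^^ i) h \<xi>" for i
    unfolding G_def by (subst fps_compose_linear) (simp add: fps_expansion_def)
  have "(\<lambda>\<eta>. d * inverse \<eta> - D \<eta> * h (\<xi> - \<eta>)) has_laurent_expansion
          fls_const d * fls_X_inv - fls_shift (int r + 1) (fps_to_fls P) * fps_to_fls G"
    by (intro laurent_expansion_intros D has_laurent_expansion_fps G)
  hence "residue (\<lambda>\<eta>. d * inverse \<eta> - D \<eta> * h (\<xi> - \<eta>)) 0 =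
          fls_residue (fls_const d * fls_X_inv - fls_shift (int r + 1) (fps_to_fls P) * fps_to_fls G)"
    by (rule has_laurent_expansion_residue_0)
  \<comment> \<open>The shift by \<open>r + 1\<close> moves index \<open>r\<close> to exponent
    \<open>- 1\<close>.\<close>
  also have "\<dots> = d - fps_nth (G * P) r"
    by (simp add: fls_shifted_times_simps fls_times_fps_to_fls[symmetric] mult.commute)
  also have "fps_nth (G * P) r =
      (\<Sum>i\<le>r. fps_nth P (r - i) * ((-1) ^ i / fact i) * (deriv ^^ i) h \<xi>)"
    by (simp add: fps_mult_nth nth atLeast0AtMost mult_ac)
  finally show ?thesis .
qed

lemma kernel_has_laurent_expansion:
  assumes D: "D has_laurent_expansion fls_shift (int r + 1) (fps_to_fls P)"
    and h: "h has_laurent_expansion H"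
  shows "(\<lambda>\<xi>. residue (\<lambda>\<eta>. D \<xi> * inverse \<eta> - D \<eta> * h (\<xi> - \<eta>)) 0) has_laurent_expansion
           fls_shift (int r + 1) (fps_to_fls P)
           - (\<Sum>i\<le>r. fls_const (fps_nth P (r - i) * ((-1) ^ i / fact i)) * (fls_deriv ^^ i) H)"
    (is "?K has_laurent_expansion ?L")
proof -
  have "(deriv ^^ i) h has_laurent_expansion (fls_deriv ^^ i) H" for i
    by (induction i) (auto intro: h has_laurent_expansion_deriv)
  hence "(\<lambda>\<xi>. D \<xi> - (\<Sum>i\<le>r. fps_nth P (r - i) * ((-1) ^ i / fact i) * (deriv ^^ i) h \<xi>))
          has_laurent_expansion ?L"
    by (intro has_laurent_expansion_diff has_laurent_expansion_sum
              has_laurent_expansion_cmult_left D)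
  \<comment> \<open>The residue formula requires \<open>h\<close> to be analytic at
    \<open>\<xi>\<close>. This holds in a punctured neighbourhood of 0, which is all that a Laurent
    expansion sees.\<close>
  also have "?this \<longleftrightarrow> ?thesis"
  proof (intro has_laurent_expansion_cong refl)
    have "eventually (\<lambda>\<xi>. h analytic_on {\<xi>}) (at 0)"
      using has_laurent_expansion_isolated_0[OF h] isolated_singularity_at_altdef by blast
    thus "eventually (\<lambda>\<xi>. D \<xi> - (\<Sum>i\<le>r. fps_nth P (r - i) * ((-1) ^ i / fact i) * (deriv ^^ i) h \<xi>)
            = ?K \<xi>) (at 0)"
      by eventually_elim (rule residue_diff_kernel[OF D, symmetric])
  qed
  finally show ?thesis .
qed

section \<open>Comparison of coefficients\<close>

lemma KK_res_coeff:
  assumes "\<omega>\<^sub>1 \<noteq> 0" "\<omega>\<^sub>2 \<noteq> 0" "Im (\<omega>\<^sub>2 / \<omega>\<^sub>1) > 0" and k: "k \<ge> 1"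
  shows "fls_nth (laurent_expansion (\<lambda>\<xi>. \<KK>_res r \<xi> x y z \<omega>\<^sub>1 \<omega>\<^sub>2) 0) (int k - 1) =
     (\<Sum>l=r+1..k+r. hurwitz l x y \<omega>\<^sub>1 \<omega>\<^sub>2 / fact l * (\<B>pow r (k+r-l) z \<omega>\<^sub>2 / fact (k+r-l)))
     + (\<Sum>l=0..r. hurwitz l x y \<omega>\<^sub>1 \<omega>\<^sub>2 / fact l
          * (\<B>pow r (k+r-l) z \<omega>\<^sub>2 / fact (k+r-l)
             - (\<Sum>j=0..r-l. \<B>pow r (r-j-l) z \<omega>\<^sub>2 / fact (r-j-l)
                  * ((-1) ^ j / fact j) * (fact (k+j-1) / fact (k-1))
                  * (\<B> (k+j) (frac (y + real r * z)) \<omega>\<^sub>2 / fact (k+j)))))"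
proof -
  define c where "c = 2 * of_real pi * \<i> / \<omega>\<^sub>2"
  define w where "w = frac (y + real r * z)"
  define h where "h = (\<lambda>l. hurwitz l x y \<omega>\<^sub>1 \<omega>\<^sub>2 / fact l)"
  define b where "b = (\<lambda>m. \<B>pow r m z \<omega>\<^sub>2 / fact m)"
  define q where "q = (\<lambda>j. (-1) ^ j / fact j * (fact (k+j-1) / fact (k-1))
                  * (\<B> (k+j) w \<omega>\<^sub>2 / fact (k+j)))"
  define P where "P = Abs_fps h * fps_scale_of_real c (bernoulli_gf z) ^ r"
  define H where "H = fls_shift 1 (fps_to_fls (fps_scale_of_real c (bernoulli_gf w)))"
  have b: "fps_nth (fps_scale_of_real c (bernoulli_gf z) ^ r) m = b m" for m
    unfolding fps_scale_of_real_power[symmetric]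
    by (simp add: b_def \<B>pow_def bernpoly_pow_def c_def fps_scale_of_real_def)
  have P: "fps_nth P n = (\<Sum>l=0..n. h l * b (n - l))" for n
    by (simp add: P_def fps_mult_nth b)
  have H: "fls_nth H (int n - 1) = \<B> n w \<omega>\<^sub>2 / fact n" for n
    by (simp add: H_def \<B>_def bernpoly_def c_def fps_scale_of_real_def)
  have "(\<lambda>\<xi>. \<DD> r \<xi> x y z \<omega>\<^sub>1 \<omega>\<^sub>2) has_laurent_expansion
     fls_shift 1 (fps_to_fls (Abs_fps h)) *
     fls_shift 1 (fps_to_fls (fps_scale_of_real c (bernoulli_gf z))) ^ r"
    unfolding \<DD>_def h_def c_def
    by (intro laurent_expansion_intros EE_has_laurent_expansion FF_has_laurent_expansion assms)
  also have "\<dots> = fls_shift (int r + 1) (fps_to_fls P)"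
    by (simp add: P_def fls_shifted_pow fls_times_both_shifted_simp fls_times_fps_to_fls
                  fps_to_fls_power add.commute)
  finally have D: "(\<lambda>\<xi>. \<DD> r \<xi> x y z \<omega>\<^sub>1 \<omega>\<^sub>2) has_laurent_expansion
     fls_shift (int r + 1) (fps_to_fls P)" .
  have F: "(\<lambda>\<xi>. \<FF> \<xi> w \<omega>\<^sub>2) has_laurent_expansion H"
    unfolding H_def c_def by (rule FF_has_laurent_expansion[OF assms(2)])
  \<comment> \<open>Under the shift by \<open>r + 1\<close>, exponent \<open>k - 1\<close>
    corresponds to index \<open>k + r\<close> of \<open>P\<close>.\<close>
  have "fls_nth (laurent_expansion (\<lambda>\<xi>. \<KK>_res r \<xi> x y z \<omega>\<^sub>1 \<omega>\<^sub>2) 0) (int k - 1) =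
     fps_nth P (k + r)
     - (\<Sum>j\<le>r. fps_nth P (r - j) * ((-1) ^ j / fact j) * fls_nth ((fls_deriv ^^ j) H) (int k - 1))"
    unfolding \<KK>_res_def w_def[symmetric]
    unfolding laurent_expansion_eqI[OF kernel_has_laurent_expansion[OF D F]]
    by (simp add: fls_nth_sum nat_add_distrib)
  also have "(\<Sum>j\<le>r. fps_nth P (r - j) * ((-1) ^ j / fact j) * fls_nth ((fls_deriv ^^ j) H) (int k - 1))
      = (\<Sum>j\<in>{0..r}. \<Sum>l\<in>{0..r-j}. h l * b (r - j - l) * q j)"
    unfolding fls_nth_deriv_funpow[OF k] H P q_def
    by (simp only: sum_distrib_right atLeast0AtMost mult.assoc)
  \<comment> \<open>Both orders of summation run over the triangle
    \<open>l + j \<le> r\<close>.\<close>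
  also have "\<dots> = (\<Sum>l\<in>{0..r}. \<Sum>j\<in>{0..r-l}. h l * b (r - j - l) * q j)"
    unfolding sum.Sigma[OF finite_atLeastAtMost ballI[OF finite_atLeastAtMost]]
    by (rule sum.reindex_bij_witness[where i = "\<lambda>(l, j). (j, l)" and j = "\<lambda>(l, j). (j, l)"]) auto
  \<comment> \<open>The Cauchy product is split at \<open>l = r\<close>, since only the terms with
    \<open>l \<le> r\<close> combine with the correction coming from the kernel.\<close>
  also have "fps_nth P (k + r) =
      (\<Sum>l=r+1..k+r. h l * b (k + r - l)) + (\<Sum>l=0..r. h l * b (k + r - l))"
    unfolding P using sum.ub_add_nat[of 0 r "\<lambda>l. h l * b (k + r - l)" k]
    by (simp add: add.commute)
  finally show ?thesis
    by (simp only: h_def b_def q_def w_def right_diff_distrib sum_subtractf sum_distrib_left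
                   mult.assoc add_diff_eq)
qed

theorem theorem5p1:
  fixes r k :: nat and x y z :: real and \<omega>\<^sub>1 \<omega>\<^sub>2 :: complex
  assumes "\<omega>\<^sub>1 \<noteq> 0" and "\<omega>\<^sub>2 \<noteq> 0" and "Im (\<omega>\<^sub>2 / \<omega>\<^sub>1) > 0"
    and "r \<ge> 1" and "k \<ge> 1"
    and "-1 < x" and "x < 1" and "-1 < y" and "y < 1"
    and "0 \<le> z" and "z \<le> 1"
  shows
    "((x, y) \<noteq> (0, 0) \<longrightarrow>
       kcoeff k r x y z \<omega>\<^sub>1 \<omega>\<^sub>2 =
         fact k * (\<Sum>l=r+1..k+r. hurwitz l x y \<omega>\<^sub>1 \<omega>\<^sub>2 / fact l
                     * (\<B>pow r (k+r-l) z \<omega>\<^sub>2 / fact (k+r-l)))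
         + fact k * (\<Sum>l=0..r. hurwitz l x y \<omega>\<^sub>1 \<omega>\<^sub>2 / fact l
                     * (\<B>pow r (k+r-l) z \<omega>\<^sub>2 / fact (k+r-l)
                        - (\<Sum>j=0..r-l. \<B>pow r (r-j-l) z \<omega>\<^sub>2 / fact (r-j-l)
                             * ((-1) ^ j / fact j) * (fact (k+j-1) / fact (k-1))
                             * (\<B> (k+j) (frac (y + real r * z)) \<omega>\<^sub>2 / fact (k+j))))))
     \<and> ((x, y) = (0, 0) \<and> z \<noteq> 1 \<longrightarrow>
       kcoeff k r 0 0 z \<omega>\<^sub>1 \<omega>\<^sub>2 =
         fact k * (\<Sum>l=r+1..k+r. hurwitz l 0 0 \<omega>\<^sub>1 \<omega>\<^sub>2 / fact l
                     * (\<B>pow r (k+r-l) z \<omega>\<^sub>2 / fact (k+r-l)))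
         + fact k * (\<Sum>l\<in>{0..r} - {1}. hurwitz l 0 0 \<omega>\<^sub>1 \<omega>\<^sub>2 / fact l
                     * (\<B>pow r (k+r-l) z \<omega>\<^sub>2 / fact (k+r-l)
                        - (\<Sum>j=0..r-l. \<B>pow r (r-j-l) z \<omega>\<^sub>2 / fact (r-j-l)
                             * ((-1) ^ j / fact j) * (fact (k+j-1) / fact (k-1))
                             * (\<B> (k+j) (frac (real r * z)) \<omega>\<^sub>2 / fact (k+j))))))"
proof (intro conjI impI, goal_cases)
  case 1
  \<comment> \<open>The exceptional triple \<open>(0, 0, 1)\<close> is excluded, here by
    \<open>(x, y)\<close> and in the second case by \<open>z \<noteq> 1\<close>.\<close>
  hence "(\<lambda>\<xi>. \<KK> r \<xi> x y z \<omega>\<^sub>1 \<omega>\<^sub>2) = (\<lambda>\<xi>. \<KK>_res r \<xi> x y z \<omega>\<^sub>1 \<omega>\<^sub>2)"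
    by (auto simp: \<KK>_def)
  thus ?case
    unfolding kcoeff_def using KK_res_coeff[OF assms(1-3,5), of r x y z]
    by (simp only: distrib_left)
next
  case 2
  hence "(\<lambda>\<xi>. \<KK> r \<xi> 0 0 z \<omega>\<^sub>1 \<omega>\<^sub>2) = (\<lambda>\<xi>. \<KK>_res r \<xi> 0 0 z \<omega>\<^sub>1 \<omega>\<^sub>2)"
    by (auto simp: \<KK>_def)
  moreover have "sum (\<lambda>l. hurwitz l 0 0 \<omega>\<^sub>1 \<omega>\<^sub>2 / fact l * g l) {0..r} =
                 sum (\<lambda>l. hurwitz l 0 0 \<omega>\<^sub>1 \<omega>\<^sub>2 / fact l * g l) ({0..r} - {1})" for g
    using hurwitz_1_0_0[OF assms(1,3)] by (intro sum.mono_neutral_right) auto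
  ultimately show ?case
    unfolding kcoeff_def using KK_res_coeff[OF assms(1-3,5), of r 0 0 z]
    by (simp only: distrib_left add_0_left)
qed

end
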